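(* Let $(X,d,\mu,\mathcal{E},\mathcal{F})$ be a strongly local metric Dirichlet space whose balls of finite radius have compact closure and whose heat semigroup $\{P_t\}_{t>0}$ has a continuous heat kernel $p_t(x,y)$ satisfying, for $\mu$-a.e. $x,y\in X$ and every $t>0$, $$\frac{c_1}{\mu(B(x,t^{1/d_W}))}\exp\Big(-c_2\Big(\frac{d(x,y)^{d_W}}{t}\Big)^{\frac1{d_W-1}}\Big)\le p_t(x,y)\le\frac{c_3}{\mu(B(x,t^{1/d_W}))}\exp\Big(-c_4\Big(\frac{d(x,y)^{d_W}}{t}\Big)^{\frac1{d_W-1}}\Big),$$ where $c_1,c_2,c_3,c_4>0$ and $d_W\ge2$. Then for any $p>1$, $$W^{1,p}(\mathcal{E})=\Big\{f\in L^p(X,\mu):\ \limsup_{r\to0^+}\frac1{r^{\alpha_pd_W}}\Big(\int_X\int_{B(x,r)}\frac{|f(y)-f(x)|^p}{\mu(B(x,r))}\,d\mu(y)\,d\mu(x)\Big)^{1/p}<\infty\Big\}.$$ Moreover, there are constants $c,C>0$ such that for any $f\in W^{1,p}(\mathcal{E})$, $$\mathbf{Var}_{p,\mathcal{E}}(f)\ge c\,\liminf_{r\to0^+}\frac1{r^{\alpha_pd_W}}\Big(\int_X\int_{B(x,r)}\frac{|f(y)-f(x)|^p}{\mu(B(x,r))}\,d\mu(y)\,d\mu(x)\Big)^{1/p}$$ and $$\mathbf{Var}_{p,\mathcal{E}}(f)\le C\,\limsup_{r\to0^+}\frac1{r^{\alpha_pd_W}}\Big(\int_X\int_{B(x,r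)}\frac{|f(y)-f(x)|^p}{\mu(B(x,r))}\,d\mu(y)\,d\mu(x)\Big)^{1/p}.$$
   Context: The heat semigroup $\{P_t\}$ of the Dirichlet form $(\mathcal{E},\mathcal{F})$ on $L^2(X,\mu)$ (extended to all $L^p(X,\mu)$) is assumed conservative: $P_t1=1$. $B(x,r)$ is the ball of $d$. For $p\ge1$, $\alpha\ge0$ (with $P_t(|f-f(y)|^p)(y)=\int_X|f(x)-f(y)|^p\,p_t(y,x)\,d\mu(x)$), $$\mathbf{B}^{p,\alpha}(X)=\Big\{f\in L^p(X,\mu):\limsup_{t\to0^+}t^{-\alpha}\Big(\int_XP_t(|f-f(y)|^p)(y)\,d\mu(y)\Big)^{1/p}<\infty\Big\}.$$ Set $\alpha_p=\sup\{\alpha>0:\mathbf{B}^{p,\alpha}(X)\text{ contains non a.e. constant functions}\}$ (understood to be a finite positive number). For $p>1$, $W^{1,p}(\mathcal{E})=\mathbf{B}^{p,\alpha_p}(X)$, and for $f\in W^{1,p}(\mathcal{E})$ $$\mathbf{Var}_{p,\mathcal{E}}(f)=\liminf_{t\to0^+}t^{-\alpha_p}\Big(\int_XP_t(|f-f(y)|^p)(y)\,d\mu(y)\Big)^{1/p}.$$ *)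

theory Defs
  imports "HOL-Analysis.Analysis"
begin

text \<open>
  Elements of function spaces are represented by real-valued Borel functions; equality in the
  space is \<^emph>\<open>equality almost everywhere\<close>.  All sets of functions below are closed under
  changing a representative on a null set.
\<close>

definition Lp_space :: "'a measure \<Rightarrow> real \<Rightarrow> ('a \<Rightarrow> real) set" where
  "Lp_space M p = {f \<in> borel_measurable M. integrable M (\<lambda>x. \<bar>f x\<bar> powr p)}"

abbreviation L2_space :: "'a measure \<Rightarrow> ('a \<Rightarrow> real) set" where
  "L2_space M \<equiv> Lp_space M 2"

definition L2_inner :: "'a measure \<Rightarrow> ('a \<Rightarrow> real) \<Rightarrow> ('a \<Rightarrow> real) \<Rightarrow> real" where
  "L2_inner M f g = (\<integral>x. f x * g x \<partial>M)"

definition L2_norm :: "'a measure \<Rightarrow> ('a \<Rightarrow> real) \<Rightarrow> real" where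
  "L2_norm M f = sqrt (L2_inner M f f)"

text \<open>A (symmetric) Dirichlet form with domain \<open>F\<close>: a densely defined, closed, symmetric,
  nonnegative and Markovian bilinear form on \<open>L\<^sup>2\<close>.\<close>

locale dirichlet_form =
  fixes M :: "'a measure"
    and E :: "('a \<Rightarrow> real) \<Rightarrow> ('a \<Rightarrow> real) \<Rightarrow> real"
    and F :: "('a \<Rightarrow> real) set"
  assumes dom_subset: "F \<subseteq> L2_space M"
    and dom_zero: "(\<lambda>x. 0) \<in> F"
    and dom_add: "\<lbrakk>f \<in> F; g \<in> F\<rbrakk> \<Longrightarrow> (\<lambda>x. f x + g x) \<in> F"
    and dom_scale: "f \<in> F \<Longrightarrow> (\<lambda>x. a * f x) \<in> F"
    and dom_cong: "\<lbrakk>f \<in> F; g \<in> borel_measurable M; AE x in M. f x = g x\<rbrakk> \<Longrightarrow> g \<in> F"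
    and form_cong: "\<lbrakk>f \<in> F; g \<in> F; h \<in> F; AE x in M. f x = g x\<rbrakk> \<Longrightarrow> E f h = E g h"
    and dom_dense: "\<lbrakk>f \<in> L2_space M; \<epsilon> > 0\<rbrakk> \<Longrightarrow> \<exists>g\<in>F. L2_norm M (\<lambda>x. f x - g x) < \<epsilon>"
    and form_add: "\<lbrakk>f \<in> F; g \<in> F; h \<in> F\<rbrakk> \<Longrightarrow> E (\<lambda>x. f x + g x) h = E f h + E g h"
    and form_scale: "\<lbrakk>f \<in> F; h \<in> F\<rbrakk> \<Longrightarrow> E (\<lambda>x. a * f x) h = a * E f h"
    and form_sym: "\<lbrakk>f \<in> F; g \<in> F\<rbrakk> \<Longrightarrow> E f g = E g f"
    and form_nonneg: "f \<in> F \<Longrightarrow> 0 \<le> E f f"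
    and closed_form:
      "\<lbrakk>\<And>n. u n \<in> F;
        \<And>\<epsilon>. \<epsilon> > 0 \<Longrightarrow> \<exists>N. \<forall>m\<ge>N. \<forall>n\<ge>N.
           E (\<lambda>x. u m x - u n x) (\<lambda>x. u m x - u n x) + (L2_norm M (\<lambda>x. u m x - u n x))\<^sup>2 < \<epsilon>\<rbrakk>
       \<Longrightarrow> \<exists>f\<in>F. (\<lambda>n. E (\<lambda>x. u n x - f x) (\<lambda>x. u n x - f x)
                       + (L2_norm M (\<lambda>x. u n x - f x))\<^sup>2) \<longlonglongrightarrow> 0"
    and markovian_dom: "f \<in> F \<Longrightarrow> (\<lambda>x. min 1 (max 0 (f x))) \<in> F"
    and markovian:
      "f \<in> F \<Longrightarrow> E (\<lambda>x. min 1 (max 0 (f x))) (\<lambda>x. min 1 (max 0 (f x))) \<le> E f f"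

text \<open>The support of the measure \<open>\<bar>f\<bar> \<mu>\<close>; it depends only on the a.e. class of \<open>f\<close>.\<close>

definition ess_support :: "'a::topological_space measure \<Rightarrow> ('a \<Rightarrow> real) \<Rightarrow> 'a set" where
  "ess_support M f = {x. \<forall>U. open U \<and> x \<in> U \<longrightarrow> \<not> (AE y in M. y \<in> U \<longrightarrow> f y = 0)}"

text \<open>Since balls will be assumed relatively compact, a Borel measure that is finite on
  compact sets is automatically Radon.  Second countability (part of the usual
  locally compact separable setting) is then automatic as well; it appears as
  a type class only so that products of Borel spaces behave well.\<close>

locale strongly_local_metric_dirichlet_space = dirichlet_form M E F
  for M :: "'a::{metric_space, second_countable_topology} measure"
    and E :: "('a \<Rightarrow> real) \<Rightarrow> ('a \<Rightarrow> real) \<Rightarrow> real"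
    and F :: "('a \<Rightarrow> real) set" +
  assumes borel_sets: "sets M = sets borel"
    and finite_on_compacts: "compact K \<Longrightarrow> emeasure M K < \<infinity>"
    and full_support: "\<lbrakk>open U; U \<noteq> {}\<rbrakk> \<Longrightarrow> 0 < emeasure M U"
    and strongly_local:
      "\<lbrakk>f \<in> F; g \<in> F; compact (ess_support M f); compact (ess_support M g);
        open U; ess_support M f \<subseteq> U; AE x in M. x \<in> U \<longrightarrow> g x = a\<rbrakk> \<Longrightarrow> E f g = 0"

text \<open>The heat semigroup of the form: the strongly continuous contraction semigroup on
  \<open>L\<^sup>2\<close> whose infinitesimal generator is the generator \<open>A\<close> of the form, where
  \<open>A f = g\<close> means \<open>f \<in> F\<close> and \<open>E f h = - \<langle>g, h\<rangle>\<close> for all \<open>h \<in> F\<close>.  By the Hille--Yosida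
  theorem this determines \<open>P\<close> uniquely (up to null sets).\<close>

locale heat_semigroup =
  fixes M :: "'a measure"
    and E :: "('a \<Rightarrow> real) \<Rightarrow> ('a \<Rightarrow> real) \<Rightarrow> real"
    and F :: "('a \<Rightarrow> real) set"
    and P :: "real \<Rightarrow> ('a \<Rightarrow> real) \<Rightarrow> ('a \<Rightarrow> real)"
  assumes maps_L2: "\<lbrakk>t > 0; f \<in> L2_space M\<rbrakk> \<Longrightarrow> P t f \<in> L2_space M"
    and cong_AE: "\<lbrakk>t > 0; f \<in> L2_space M; g \<in> L2_space M; AE x in M. f x = g x\<rbrakk>
      \<Longrightarrow> AE x in M. P t f x = P t g x"
    and linear_add: "\<lbrakk>t > 0; f \<in> L2_space M; g \<in> L2_space M\<rbrakk>
      \<Longrightarrow> AE x in M. P t (\<lambda>z. f z + g z) x = P t f x + P t g x"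
    and linear_scale: "\<lbrakk>t > 0; f \<in> L2_space M\<rbrakk>
      \<Longrightarrow> AE x in M. P t (\<lambda>z. a * f z) x = a * P t f x"
    and contraction: "\<lbrakk>t > 0; f \<in> L2_space M\<rbrakk> \<Longrightarrow> L2_norm M (P t f) \<le> L2_norm M f"
    and semigroup: "\<lbrakk>s > 0; t > 0; f \<in> L2_space M\<rbrakk>
      \<Longrightarrow> AE x in M. P (s + t) f x = P s (P t f) x"
    and strongly_continuous: "f \<in> L2_space M
      \<Longrightarrow> ((\<lambda>t. L2_norm M (\<lambda>x. P t f x - f x)) \<longlongrightarrow> 0) (at_right 0)"
    and generator: "\<lbrakk>f \<in> L2_space M; g \<in> L2_space M\<rbrakk>
      \<Longrightarrow> ((\<lambda>t. L2_norm M (\<lambda>x. (P t f x - f x) / t - g x)) \<longlongrightarrow> 0) (at_right 0)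
          \<longleftrightarrow> f \<in> F \<and> (\<forall>h\<in>F. E f h = - L2_inner M g h)"

text \<open>\<open>P\<^sub>t 1 = 1\<close>, where \<open>P\<^sub>t 1\<close> is the value of the extension of \<open>P\<^sub>t\<close> to
  bounded functions, obtained by monotone approximation of \<open>1\<close> from within \<open>L\<^sup>2\<close>.\<close>

definition conservative :: "'a measure \<Rightarrow> (real \<Rightarrow> ('a \<Rightarrow> real) \<Rightarrow> ('a \<Rightarrow> real)) \<Rightarrow> bool" where
  "conservative M P \<longleftrightarrow>
     (\<forall>t>0. \<forall>u. (\<forall>n. u n \<in> L2_space M) \<and> (\<forall>n x. 0 \<le> u n x \<and> u n x \<le> u (Suc n) x)
              \<and> (\<forall>x. (\<lambda>n. u n x) \<longlonglongrightarrow> 1)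
        \<longrightarrow> (AE x in M. (\<lambda>n. P t (u n) x) \<longlonglongrightarrow> 1))"

locale continuous_heat_kernel =
  fixes M :: "'a::topological_space measure"
    and P :: "real \<Rightarrow> ('a \<Rightarrow> real) \<Rightarrow> ('a \<Rightarrow> real)"
    and k :: "real \<Rightarrow> 'a \<Rightarrow> 'a \<Rightarrow> real"
  assumes kernel_nonneg: "t > 0 \<Longrightarrow> 0 \<le> k t x y"
    and kernel_continuous: "t > 0 \<Longrightarrow> continuous_on UNIV (\<lambda>(x, y). k t x y)"
    and kernel_represents: "\<lbrakk>t > 0; f \<in> L2_space M\<rbrakk>
      \<Longrightarrow> AE x in M. integrable M (\<lambda>y. k t x y * f y) \<and> P t f x = (\<integral>y. k t x y * f y \<partial>M)"

text \<open>The expression \<open>exp (- c (d(x,y)\<^bsup>w\<^esup> / t)\<^bsup>1/(w-1)\<^esup>) / \<mu>(B(x, t\<^bsup>1/w\<^esup>))\<close>, with \<open>w\<close> the walk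
  dimension.\<close>

definition sub_gaussian :: "'a::metric_space measure \<Rightarrow> real \<Rightarrow> real \<Rightarrow> real \<Rightarrow> 'a \<Rightarrow> 'a \<Rightarrow> real" where
  "sub_gaussian M w c t x y =
     exp (- c * ((dist x y powr w) / t) powr (1 / (w - 1))) / measure M (ball x (t powr (1 / w)))"

text \<open>Real powers \<open>x\<^sup>a\<close>, \<open>a > 0\<close>, of extended nonnegative numbers.\<close>

definition enn_powr :: "ennreal \<Rightarrow> real \<Rightarrow> ennreal" where
  "enn_powr x a = (if x = \<infinity> then \<infinity> else ennreal (enn2real x powr a))"

definition heat_osc ::
    "'a measure \<Rightarrow> (real \<Rightarrow> 'a \<Rightarrow> 'a \<Rightarrow> real) \<Rightarrow> real \<Rightarrow> real \<Rightarrow> ('a \<Rightarrow> real) \<Rightarrow> real \<Rightarrow> ennreal" where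
  "heat_osc M k p \<alpha> f t = ennreal (t powr (- \<alpha>)) *
     enn_powr (\<integral>\<^sup>+y. (\<integral>\<^sup>+x. ennreal (\<bar>f x - f y\<bar> powr p * k t y x) \<partial>M) \<partial>M) (1 / p)"

definition besov ::
    "'a measure \<Rightarrow> (real \<Rightarrow> 'a \<Rightarrow> 'a \<Rightarrow> real) \<Rightarrow> real \<Rightarrow> real \<Rightarrow> ('a \<Rightarrow> real) set" where
  "besov M k p \<alpha> = {f \<in> Lp_space M p. Limsup (at_right 0) (heat_osc M k p \<alpha> f) < \<infinity>}"

definition nontrivial_exponents ::
    "'a measure \<Rightarrow> (real \<Rightarrow> 'a \<Rightarrow> 'a \<Rightarrow> real) \<Rightarrow> real \<Rightarrow> real set" where
  "nontrivial_exponents M k p =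
     {\<alpha>. \<alpha> > 0 \<and> (\<exists>f\<in>besov M k p \<alpha>. \<not> (\<exists>a. AE x in M. f x = a))}"

text \<open>Meaningful only if the set is nonempty and bounded above, i.e. if the
  supremum is a finite positive number.\<close>

definition critical_exponent ::
    "'a measure \<Rightarrow> (real \<Rightarrow> 'a \<Rightarrow> 'a \<Rightarrow> real) \<Rightarrow> real \<Rightarrow> real" where
  "critical_exponent M k p = Sup (nontrivial_exponents M k p)"

definition sobolev ::
    "'a measure \<Rightarrow> (real \<Rightarrow> 'a \<Rightarrow> 'a \<Rightarrow> real) \<Rightarrow> real \<Rightarrow> ('a \<Rightarrow> real) set" where
  "sobolev M k p = besov M k p (critical_exponent M k p)"

definition Var ::
    "'a measure \<Rightarrow> (real \<Rightarrow> 'a \<Rightarrow> 'a \<Rightarrow> real) \<Rightarrow> real \<Rightarrow> ('a \<Rightarrow> real) \<Rightarrow> ennreal" where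
  "Var M k p f = Liminf (at_right 0) (heat_osc M k p (critical_exponent M k p) f)"

definition ball_osc ::
    "'a::metric_space measure \<Rightarrow> real \<Rightarrow> real \<Rightarrow> ('a \<Rightarrow> real) \<Rightarrow> real \<Rightarrow> ennreal" where
  "ball_osc M p \<beta> f r = ennreal (1 / r powr \<beta>) *
     enn_powr (\<integral>\<^sup>+x. (\<integral>\<^sup>+y\<in>ball x r. ennreal (\<bar>f y - f x\<bar> powr p / measure M (ball x r)) \<partial>M) \<partial>M)
       (1 / p)"

end

theory Submission
  imports Defs
begin

text \<open>
  Under the time change \<open>t = r powr w\<close> the length scale of the kernel is \<open>r\<close>, and
  \<open>t powr (- \<alpha>) = r powr (- (\<alpha> * w))\<close>, so both seminorms carry the same prefactor and only two
  double integrals have to be compared: the heat energy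
  \<open>A(r) = \<integral>\<integral> \<bar>f x - f y\<bar>\<^sup>p k t y x\<close> and the ball energy \<open>B(r)\<close>, in which the kernel is replaced by
  \<open>1 / \<mu>(B(y,r))\<close> on the ball \<open>B(y,r)\<close>.

  One direction is immediate (\<open>ball_energy_le_heat_energy\<close>): on \<open>B(y,r)\<close> the lower kernel bound is at
  least a constant times \<open>1 / \<mu>(B(y,r))\<close>, whence \<open>c B(r) \<le> A(r)\<close> for every \<open>r\<close>.

  For the other direction the measure must be doubling, and this follows from the same lower bound:
  the kernel has total mass at most 1, while on \<open>B(x,2r)\<close> it is at least a constant times
  \<open>1 / \<mu>(B(x,r))\<close>, so \<open>\<mu>(B(x,2r)) \<le> D \<mu>(B(x,r))\<close> for almost every \<open>x\<close> (\<open>doubling\<close>).  Cutting the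
  space around \<open>y\<close> into the dyadic shells of radii \<open>2\<^sup>j r\<close>, the exponential decay of the upper
  bound beats the factor \<open>D\<^sup>j\<close> lost in comparing \<open>\<mu>(B(y,r))\<close> with \<open>\<mu>(B(y,2\<^sup>j r))\<close>, and
  \<open>A(r) \<le> \<Sum>\<^sub>j b\<^sub>j B(2\<^sup>j r)\<close> with weights \<open>b\<^sub>j\<close> that decay faster than any power of \<open>2\<^sup>j\<close>
  (\<open>heat_energy_le_sum_ball_energy\<close>).

  Suppose now that \<open>B(s) \<le> L s\<^sup>\<gamma>\<close> for small \<open>s\<close>.  For the large scales in the sum only
  \<open>f \<in> L\<^sup>p\<close> is available; by doubling and Fubini it bounds \<open>B\<close> by a constant, and a constant is at
  most \<open>K s\<^bsup>\<gamma>+1\<^esup>\<close> away from zero.  Thus \<open>B(s) \<le> L s\<^sup>\<gamma> + K s\<^bsup>\<gamma>+1\<^esup>\<close> for all \<open>s\<close>, and summation gives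
  \<open>A(r) \<le> r\<^sup>\<gamma> (L S + r K S')\<close>, where \<open>S\<close> and \<open>S'\<close> are moments of the weights.  The second term
  vanishes in the limit, so the upper limit of the normalised \<open>A\<close> is controlled by that of \<open>B\<close>
  (\<open>Limsup_heat_osc_le\<close>) with a constant independent of \<open>f\<close>.
\<close>

section \<open>Fractional powers and limits at zero\<close>

lemma enn_powr_mono:
  assumes "x \<le> y" "0 \<le> a"
  shows "enn_powr x a \<le> enn_powr y a"
proof (cases "y = \<infinity>")
  case False
  then have "x < \<infinity>" "y < \<infinity>"
    using assms(1) by (auto simp: less_top[symmetric] top_unique)
  then show ?thesis
    using assms by (auto simp: enn_powr_def intro!: powr_mono2 enn2real_mono)
qed (simp add: enn_powr_def)

lemma enn_powr_ennreal: "0 \<le> x \<Longrightarrow> enn_powr (ennreal x) a = ennreal (x powr a)"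
  by (simp add: enn_powr_def)

lemma enn_powr_cmult:
  assumes "0 < c"
  shows "enn_powr (ennreal c * x) a = ennreal (c powr a) * enn_powr x a"
proof (cases x)
  case (real y)
  then show ?thesis
    using assms by (simp add: enn_powr_ennreal ennreal_mult[symmetric] powr_mult)
next
  case top
  then show ?thesis
    using assms by (simp add: enn_powr_def ennreal_mult_top)
qed

lemma le_if_enn_powr_inverse_le:
  assumes "enn_powr x (1 / p) \<le> ennreal b" "0 < p" "0 \<le> b"
  shows "x \<le> ennreal (b powr p)"
proof (cases x)
  case (real y)
  then have "y powr (1 / p) \<le> b"
    using assms by (simp add: enn_powr_ennreal)
  then have "(y powr (1 / p)) powr p \<le> b powr p"
    using assms by (intro powr_mono2) auto
  then show ?thesis
    using real assms by (simp add: powr_powr ennreal_leI)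
next
  case top
  then show ?thesis
    using assms by (simp add: enn_powr_def top_unique)
qed

lemma abs_diff_powr_le:
  fixes a b p :: real
  assumes "0 \<le> p"
  shows "\<bar>a - b\<bar> powr p \<le> 2 powr p * (\<bar>a\<bar> powr p + \<bar>b\<bar> powr p)"
proof -
  have "\<bar>a - b\<bar> powr p \<le> (2 * max \<bar>a\<bar> \<bar>b\<bar>) powr p"
    using assms by (intro powr_mono2) auto
  also have "\<dots> = 2 powr p * max \<bar>a\<bar> \<bar>b\<bar> powr p"
    by (simp add: powr_mult)
  also have "\<dots> \<le> 2 powr p * (\<bar>a\<bar> powr p + \<bar>b\<bar> powr p)"
    by (intro mult_left_mono) (auto simp: max_def)
  finally show ?thesis .
qed

lemma filtermap_powr_at_right_0:
  assumes "0 < w"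
  shows "filtermap (\<lambda>r::real. r powr w) (at_right 0) = at_right 0"
proof (rule filtermap_fun_inverse)
  have *: "filterlim (\<lambda>r::real. r powr a) (at_right 0) (at_right 0)" if "0 < a" for a
    unfolding filterlim_at
    using that by (auto intro!: tendsto_eq_intros eventually_at_rightI[of 0 1])
  show "filterlim (\<lambda>r::real. r powr w) (at_right 0) (at_right 0)"
    "filterlim (\<lambda>r::real. r powr (1 / w)) (at_right 0) (at_right 0)"
    using * assms by auto
  show "\<forall>\<^sub>F r::real in at_right 0. (r powr (1 / w)) powr w = r"
    using assms by (intro eventually_at_rightI[of 0 1]) (auto simp: powr_powr)
qed

text \<open>
  Lower and upper limits at zero are invariant under the time change.  Each inequality is the
  one-sided estimate for image filters, applied to the map \<open>r \<mapsto> r powr w\<close> or to its inverse.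
\<close>
lemma Liminf_at_right_0_powr:
  fixes h :: "real \<Rightarrow> ennreal"
  assumes "0 < w"
  shows "Liminf (at_right 0) (\<lambda>r. h (r powr w)) = Liminf (at_right 0) h"
proof (rule antisym)
  have "Liminf (at_right 0) (\<lambda>r. h (r powr w))
      = Liminf (filtermap (\<lambda>r. r powr (1 / w)) (at_right 0)) (\<lambda>r. h (r powr w))"
    using assms by (simp add: filtermap_powr_at_right_0)
  also have "\<dots> \<le> Liminf (at_right 0) (\<lambda>r. h ((r powr (1 / w)) powr w))"
    by (rule Liminf_filtermap_le)
  also have "\<dots> = Liminf (at_right 0) h"
    using assms
    by (intro Liminf_eq eventually_mono[OF eventually_at_right_less[of 0]]) (simp add: powr_powr)
  finally show "Liminf (at_right 0) (\<lambda>r. h (r powr w)) \<le> Liminf (at_right 0) h" .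
  show "Liminf (at_right 0) h \<le> Liminf (at_right 0) (\<lambda>r. h (r powr w))"
    using Liminf_filtermap_le[of "\<lambda>r. r powr w" "at_right 0" h] assms
    by (simp add: filtermap_powr_at_right_0)
qed

lemma Limsup_at_right_0_powr:
  fixes h :: "real \<Rightarrow> ennreal"
  assumes "0 < w"
  shows "Limsup (at_right 0) (\<lambda>r. h (r powr w)) = Limsup (at_right 0) h"
proof (rule antisym)
  have "Limsup (at_right 0) h = Limsup (at_right 0) (\<lambda>r. h ((r powr (1 / w)) powr w))"
    using assms
    by (intro Limsup_eq eventually_mono[OF eventually_at_right_less[of 0]]) (simp add: powr_powr)
  also have "\<dots> \<le> Limsup (filtermap (\<lambda>r. r powr (1 / w)) (at_right 0)) (\<lambda>r. h (r powr w))"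
    by (rule Limsup_filtermap_ge)
  also have "\<dots> = Limsup (at_right 0) (\<lambda>r. h (r powr w))"
    using assms by (simp add: filtermap_powr_at_right_0)
  finally show "Limsup (at_right 0) h \<le> Limsup (at_right 0) (\<lambda>r. h (r powr w))" .
  show "Limsup (at_right 0) (\<lambda>r. h (r powr w)) \<le> Limsup (at_right 0) h"
    using Limsup_filtermap_ge[where F = "at_right 0" and f = "\<lambda>r. r powr w" and g = h] assms
    by (simp add: filtermap_powr_at_right_0)
qed

text \<open>
  The decay of the kernel across dyadic shells absorbs every geometric growth, in particular the
  powers of the doubling constant.
\<close>
lemma summable_power_mult_exp_neg_pow2:
  assumes "0 < c" "0 \<le> R"
  shows "summable (\<lambda>j. R ^ j * exp (- c * 2 ^ j) :: real)"
proof -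
  have "(\<lambda>j. R * exp (- (c * 2 ^ j))) \<longlonglongrightarrow> R * 0"
  proof (intro tendsto_intros filterlim_compose[OF exp_at_bot])
    have "filterlim (\<lambda>j. c * 2 ^ j :: real) at_top sequentially"
      using assms(1)
      by (intro filterlim_tendsto_pos_mult_at_top[OF tendsto_const]
          filterlim_at_top_mono[OF filterlim_real_sequentially] always_eventually)
        (auto intro!: less_imp_le of_nat_less_two_power)
    then show "filterlim (\<lambda>j. - (c * 2 ^ j) :: real) at_bot sequentially"
      by (rule filterlim_compose[OF filterlim_uminus_at_bot_at_top])
  qed
  then have "\<forall>\<^sub>F j in sequentially. R * exp (- (c * 2 ^ j)) < 1 / 2"
    by (rule order_tendstoD) auto
  then obtain N where N: "\<And>j. j \<ge> N \<Longrightarrow> R * exp (- (c * 2 ^ j)) < 1 / 2"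
    by (auto simp: eventually_sequentially)
  show ?thesis
  proof (rule summable_ratio_test[of "1 / 2" N])
    fix j assume "N \<le> j"
    have "exp (- c * 2 ^ Suc j) = exp (- (c * 2 ^ j)) * exp (- c * 2 ^ j)"
      by (simp add: exp_add[symmetric])
    then have "R ^ Suc j * exp (- c * 2 ^ Suc j)
        = (R * exp (- (c * 2 ^ j))) * (R ^ j * exp (- c * 2 ^ j))"
      by (simp add: mult_ac)
    also have "\<dots> \<le> 1 / 2 * (R ^ j * exp (- c * 2 ^ j))"
      using N[OF \<open>N \<le> j\<close>] assms by (intro mult_right_mono) auto
    finally show "norm (R ^ Suc j * exp (- c * 2 ^ Suc j)) \<le> 1 / 2 * norm (R ^ j * exp (- c * 2 ^ j))"
      using assms by (simp add: abs_mult)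
  qed simp
qed

section \<open>Heat energy and ball energy\<close>

definition heat_energy ::
    "'a measure \<Rightarrow> (real \<Rightarrow> 'a \<Rightarrow> 'a \<Rightarrow> real) \<Rightarrow> real \<Rightarrow> ('a \<Rightarrow> real) \<Rightarrow> real \<Rightarrow> ennreal" where
  "heat_energy M k p f t = (\<integral>\<^sup>+y. (\<integral>\<^sup>+x. ennreal (\<bar>f x - f y\<bar> powr p * k t y x) \<partial>M) \<partial>M)"

definition ball_energy :: "'a::metric_space measure \<Rightarrow> real \<Rightarrow> ('a \<Rightarrow> real) \<Rightarrow> real \<Rightarrow> ennreal" where
  "ball_energy M p f r =
     (\<integral>\<^sup>+x. (\<integral>\<^sup>+y\<in>ball x r. ennreal (\<bar>f y - f x\<bar> powr p / measure M (ball x r)) \<partial>M) \<partial>M)"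

text \<open>
  At \<open>t = r powr w\<close> the prefactors of the two oscillation functionals coincide, which reduces
  their comparison to that of the energies.
\<close>
lemma heat_osc_eq:
  assumes "0 < r" "0 < w"
  shows "heat_osc M k p \<alpha> f (r powr w) =
    ennreal (r powr (- (\<alpha> * w))) * enn_powr (heat_energy M k p f (r powr w)) (1 / p)"
  using assms by (simp add: heat_osc_def heat_energy_def powr_powr mult.commute)

lemma ball_osc_eq:
  "ball_osc M p \<beta> f r = ennreal (r powr (- \<beta>)) * enn_powr (ball_energy M p f r) (1 / p)"
  by (simp add: ball_osc_def ball_energy_def powr_minus_divide)

locale finite_ball_measure =
  fixes M :: "'a::{metric_space, second_countable_topology} measure"
  assumes sets_M: "sets M = sets borel"
    and emeasure_ball_finite: "emeasure M (ball x r) < \<infinity>"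
    and emeasure_ball_pos: "0 < r \<Longrightarrow> 0 < emeasure M (ball x r)"
begin

lemma ball_sets [measurable]: "ball x r \<in> sets M"
  by (simp add: sets_M)

lemma space_M [simp]: "space M = UNIV"
  using sets_eq_imp_space_eq[OF sets_M] by simp

lemma emeasure_ball: "emeasure M (ball x r) = ennreal (measure M (ball x r))"
  using emeasure_ball_finite[of x r] by (intro emeasure_eq_ennreal_measure) auto

lemma measure_ball_pos: "0 < r \<Longrightarrow> 0 < measure M (ball x r)"
  using emeasure_ball_pos[of r x] by (simp add: emeasure_ball)

lemma measure_ball_mono: "ball x r \<subseteq> ball y s \<Longrightarrow> measure M (ball x r) \<le> measure M (ball y s)"
  using emeasure_mono[of "ball x r" "ball y s" M] by (simp add: emeasure_ball)

sublocale sigma_finite_measure M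
proof
  obtain x0 :: 'a where True by simp
  have "\<exists>n. dist x0 y < real n" for y
    using reals_Archimedean2 by blast
  then have "(\<Union>n. ball x0 (real n)) = UNIV"
    by auto
  then show "\<exists>A. countable A \<and> A \<subseteq> sets M \<and> \<Union> A = space M \<and> (\<forall>a\<in>A. emeasure M a \<noteq> \<infinity>)"
    using emeasure_ball_finite[of x0]
    by (intro exI[of _ "range (\<lambda>n. ball x0 (real n))"]) (auto simp: less_top)
qed

lemma id_measurable_borel [measurable]: "(\<lambda>x. x) \<in> M \<rightarrow>\<^sub>M borel"
  by (simp add: measurable_cong_sets[OF sets_M refl])

lemma measurable_ball_pred [measurable]:
  assumes [measurable]: "g \<in> N \<rightarrow>\<^sub>M M" "h \<in> N \<rightarrow>\<^sub>M M"
  shows "Measurable.pred N (\<lambda>z. g z \<in> ball (h z) r)"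
proof -
  have [measurable]: "g \<in> N \<rightarrow>\<^sub>M borel" "h \<in> N \<rightarrow>\<^sub>M borel"
    using assms by (simp_all add: measurable_cong_sets[OF refl sets_M])
  show ?thesis
    unfolding mem_ball by measurable
qed

lemma borel_measurable_measure_ball [measurable]: "(\<lambda>x. measure M (ball x r)) \<in> borel_measurable M"
proof -
  have "measure M (ball x r) = enn2real (\<integral>\<^sup>+y. indicator (ball x r) y \<partial>M)" for x
    by (simp add: measure_def)
  moreover have "(\<lambda>x. enn2real (\<integral>\<^sup>+y. indicator (ball x r) y \<partial>M)) \<in> borel_measurable M"
    unfolding indicator_def by measurable
  ultimately show ?thesis
    by simp
qed

lemma ball_weight_measurable [measurable]:
  assumes [measurable]: "f \<in> borel_measurable M"
  shows "(\<lambda>(x, y). ennreal (\<bar>f y - f x\<bar> powr p / measure M (ball x r)) * indicator (ball x r) y)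
    \<in> borel_measurable (M \<Otimes>\<^sub>M M)"
  unfolding indicator_def by measurable

lemma ball_energy_eq:
  "ball_energy M p f r =
    (\<integral>\<^sup>+x. (\<integral>\<^sup>+y. ennreal (\<bar>f y - f x\<bar> powr p / measure M (ball x r)) * indicator (ball x r) y \<partial>M) \<partial>M)"
  by (simp add: ball_energy_def)

end

section \<open>Doubling from the lower kernel bound\<close>

text \<open>
  Both directions of the comparison, and doubling, follow from the two-sided kernel bounds together
  with the mass bound \<open>sub_markov\<close>, which turns pointwise lower bounds for the kernel into upper
  bounds for volumes of balls.
\<close>
locale sub_gaussian_kernel = finite_ball_measure M
  for M :: "'a::{metric_space, second_countable_topology} measure" +
  fixes k :: "real \<Rightarrow> 'a \<Rightarrow> 'a \<Rightarrow> real"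
    and c1 c2 c3 c4 w :: real
  assumes constants: "0 < c1" "0 < c2" "0 < c3" "0 < c4" "1 < w"
    and sub_markov: "0 < t \<Longrightarrow> AE x in M. \<forall>s. (\<integral>\<^sup>+y\<in>ball x s. ennreal (k t x y) \<partial>M) \<le> 1"
    and estimates: "AE x in M. AE y in M. \<forall>t>0.
          c1 * sub_gaussian M w c2 t x y \<le> k t x y \<and>
          k t x y \<le> c3 * sub_gaussian M w c4 t x y"
begin

text \<open>
  The kernel decays in the rescaled distance \<open>d / r\<close>, \<open>r = t powr (1 / w)\<close>, with this exponent.
\<close>
definition \<theta> :: real where
  "\<theta> = w / (w - 1)"

lemma \<theta>_ge_1: "1 \<le> \<theta>"
  using constants by (simp add: \<theta>_def)

lemma sub_gaussian_at_scale:
  assumes "0 < r"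
  shows "sub_gaussian M w c (r powr w) x y =
    exp (- c * (dist x y / r) powr \<theta>) / measure M (ball x r)"
proof -
  have "(dist x y powr w / r powr w) powr (1 / (w - 1)) = (dist x y / r) powr \<theta>"
    using assms by (simp add: powr_divide[symmetric] powr_powr \<theta>_def)
  moreover have "(r powr w) powr (1 / w) = r"
    using assms constants by (simp add: powr_powr)
  ultimately show ?thesis
    by (simp add: sub_gaussian_def)
qed

lemma kernel_at_scale:
  assumes "0 < r"
  shows "AE x in M. AE y in M.
    c1 * exp (- c2 * (dist x y / r) powr \<theta>) / measure M (ball x r) \<le> k (r powr w) x y \<and>
    k (r powr w) x y \<le> c3 * exp (- c4 * (dist x y / r) powr \<theta>) / measure M (ball x r)"
  using estimates
proof eventually_elim
  case (elim x)
  then show ?case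
  proof eventually_elim
    case (elim y)
    from elim[rule_format, of "r powr w"] show ?case
      using assms by (simp add: sub_gaussian_at_scale)
  qed
qed

text \<open>
  Two values of \<open>a\<close> matter: \<open>a = 1\<close> compares the kernel with the uniform distribution on a ball,
  and \<open>a = 2\<close> sees beyond the radius in the normalising volume, which yields doubling.
\<close>
lemma kernel_lower_bound_on_ball:
  assumes "0 < r" "0 < a"
  shows "AE x in M. AE y in M. y \<in> ball x (a * r) \<longrightarrow>
    c1 * exp (- c2 * a powr \<theta>) / measure M (ball x r) \<le> k (r powr w) x y"
  using kernel_at_scale[OF assms(1)]
proof eventually_elim
  case (elim x)
  then show ?case
  proof eventually_elim
    case (elim y)
    show ?case
    proof
      assume "y \<in> ball x (a * r)"
      then have "dist x y / r \<le> a"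
        using assms by (simp add: field_simps)
      then have "(dist x y / r) powr \<theta> \<le> a powr \<theta>"
        using assms \<theta>_ge_1 by (intro powr_mono2) auto
      then have "c1 * exp (- c2 * a powr \<theta>) / measure M (ball x r)
          \<le> c1 * exp (- c2 * (dist x y / r) powr \<theta>) / measure M (ball x r)"
        using constants by (intro divide_right_mono mult_left_mono) auto
      with elim show "c1 * exp (- c2 * a powr \<theta>) / measure M (ball x r) \<le> k (r powr w) x y"
        by simp
    qed
  qed
qed

lemma ball_energy_le_heat_energy:
  assumes [measurable]: "f \<in> borel_measurable M" and "0 < r"
  shows "ennreal (c1 * exp (- c2)) * ball_energy M p f r \<le> heat_energy M k p f (r powr w)"
proof -
  have "ennreal (c1 * exp (- c2)) * ball_energy M p f r = (\<integral>\<^sup>+x. (\<integral>\<^sup>+y. ennreal (c1 * exp (- c2)) *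
      (ennreal (\<bar>f y - f x\<bar> powr p / measure M (ball x r)) * indicator (ball x r) y) \<partial>M) \<partial>M)"
    unfolding ball_energy_eq by (subst nn_integral_cmult[symmetric], measurable) (subst nn_integral_cmult, simp_all)
  also have "\<dots> \<le> heat_energy M k p f (r powr w)"
    unfolding heat_energy_def
  proof (intro nn_integral_mono_AE, use kernel_lower_bound_on_ball[OF \<open>0 < r\<close> zero_less_one] in eventually_elim)
    case (elim x)
    show ?case
    proof (rule nn_integral_mono_AE, use elim[simplified] in eventually_elim)
      case (elim y)
      then have "\<bar>f y - f x\<bar> powr p * (c1 * exp (- c2) / measure M (ball x r))
          \<le> \<bar>f y - f x\<bar> powr p * k (r powr w) x y" if "y \<in> ball x r"
        using that by (intro mult_left_mono) auto
      then show ?case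
        using constants
        by (auto simp: indicator_def ennreal_mult'[symmetric] mult_ac intro!: ennreal_leI)
    qed
  qed
  finally show ?thesis .
qed

text \<open>
  The inverse of the constant \<open>c1 * exp (- c2 * a powr \<theta>)\<close> above for \<open>a = 2\<close>.
\<close>
definition doubling_const :: real where
  "doubling_const = exp (c2 * 2 powr \<theta>) / c1"

lemma doubling_const_pos: "0 < doubling_const"
  using constants by (simp add: doubling_const_def)

text \<open>
  Integrating the lower bound for \<open>k (r powr w) x\<close> over \<open>ball x (2 * r)\<close> gives at least
  \<open>measure M (ball x (2 * r)) / (doubling_const * measure M (ball x r))\<close>, and the kernel has mass at
  most 1.  The exceptional null set depends on \<open>r\<close>; since only countably many scales enter at a
  time, this is harmless.
\<close>
lemma doubling:
  assumes "0 < r"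
  shows "AE x in M. measure M (ball x (2 * r)) \<le> doubling_const * measure M (ball x r)"
proof -
  have "0 < r powr w"
    using assms by simp
  from kernel_lower_bound_on_ball[OF \<open>0 < r\<close>, of 2, simplified] sub_markov[OF this]
  show ?thesis
  proof eventually_elim
    case (elim x)
    have pos: "0 < measure M (ball x r)"
      by (rule measure_ball_pos[OF assms])
    have const_eq: "c1 * exp (- c2 * 2 powr \<theta>) = 1 / doubling_const"
      by (simp add: doubling_const_def exp_minus field_simps)
    have "ennreal (measure M (ball x (2 * r)) / (doubling_const * measure M (ball x r)))
        = (\<integral>\<^sup>+y. ennreal (1 / (doubling_const * measure M (ball x r))) * indicator (ball x (2 * r)) y \<partial>M)"
      using doubling_const_pos pos
      by (simp add: nn_integral_cmult_indicator emeasure_ball ennreal_mult'[symmetric])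
    also have "\<dots> \<le> (\<integral>\<^sup>+y\<in>ball x (2 * r). ennreal (k (r powr w) x y) \<partial>M)"
      using elim(1) const_eq
      by (intro nn_integral_mono_AE) (auto simp: indicator_def intro!: ennreal_leI)
    also have "\<dots> \<le> 1"
      using elim(2) by simp
    finally show ?case
      using doubling_const_pos pos by (simp add: field_simps)
  qed
qed

lemma doubling_iterated:
  assumes "0 < r"
  shows "AE x in M. \<forall>j. measure M (ball x (2 ^ j * r)) \<le> doubling_const ^ j * measure M (ball x r)"
proof -
  have "AE x in M. \<forall>j. measure M (ball x (2 * (2 ^ j * r))) \<le> doubling_const * measure M (ball x (2 ^ j * r))"
    using assms by (subst AE_all_countable) (intro allI doubling, simp)
  then show ?thesis
  proof eventually_elim
    case (elim x)
    show ?case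
    proof
      fix j
      show "measure M (ball x (2 ^ j * r)) \<le> doubling_const ^ j * measure M (ball x r)"
      proof (induction j)
        case (Suc j)
        have "measure M (ball x (2 ^ Suc j * r)) \<le> doubling_const * measure M (ball x (2 ^ j * r))"
          using elim[rule_format, of j] by (simp add: mult.assoc)
        also have "\<dots> \<le> doubling_const * (doubling_const ^ j * measure M (ball x r))"
          using Suc doubling_const_pos by (intro mult_left_mono) auto
        finally show ?case
          by (simp add: mult_ac)
      qed simp
    qed
  qed
qed

text \<open>
  If \<open>x\<close> lies in \<open>ball y s\<close> then \<open>ball y s \<subseteq> ball x (2 * s)\<close>, so by doubling at \<open>x\<close> the volume of
  \<open>ball x s\<close> is comparable with that of \<open>ball y s\<close>; the comparison is used for almost every \<open>x\<close>
  but every \<open>y\<close>.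
\<close>
lemma averaged_ball_mass_le:
  assumes "0 < s"
  shows "(\<integral>\<^sup>+x. ennreal (1 / measure M (ball x s)) * indicator (ball y s) x \<partial>M) \<le> ennreal doubling_const"
proof -
  have pos: "0 < measure M (ball x s)" for x
    by (rule measure_ball_pos[OF assms])
  have "(\<integral>\<^sup>+x. ennreal (1 / measure M (ball x s)) * indicator (ball y s) x \<partial>M)
      \<le> (\<integral>\<^sup>+x. ennreal (doubling_const / measure M (ball y s)) * indicator (ball y s) x \<partial>M)"
  proof (rule nn_integral_mono_AE, use doubling[OF assms] in eventually_elim)
    case (elim x)
    show ?case
    proof (cases "x \<in> ball y s")
      case True
      have "ball y s \<subseteq> ball x (2 * s)"
      proof
        fix z assume "z \<in> ball y s"
        then show "z \<in> ball x (2 * s)"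
          using True dist_triangle[of x z y] by (simp add: dist_commute)
      qed
      then have "measure M (ball y s) \<le> doubling_const * measure M (ball x s)"
        using elim measure_ball_mono by (meson order_trans)
      then have "1 / measure M (ball x s) \<le> doubling_const / measure M (ball y s)"
        using pos[of x] pos[of y] by (simp add: field_simps)
      then show ?thesis
        using True by (auto intro!: ennreal_leI)
    qed simp
  qed
  also have "\<dots> = ennreal doubling_const"
    using pos[of y] doubling_const_pos
    by (simp add: nn_integral_cmult_indicator emeasure_ball ennreal_mult'[symmetric])
  finally show ?thesis .
qed

section \<open>Upper bound by a sum over dyadic shells\<close>

text \<open>
  The crude bound that controls all large scales.  After splitting \<open>\<bar>f y - f x\<bar> powr p\<close>, the term with
  the centre \<open>x\<close> integrates to the norm exactly; in the term with \<open>y\<close> the order of integration is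
  exchanged, and what remains is the averaged mass bounded above.
\<close>
lemma ball_energy_le_norm:
  assumes [measurable]: "f \<in> borel_measurable M" and "0 < s" "0 \<le> p"
  shows "ball_energy M p f s
    \<le> ennreal (2 powr p * (1 + doubling_const)) * (\<integral>\<^sup>+x. ennreal (\<bar>f x\<bar> powr p) \<partial>M)"
proof -
  define g where "g x = ennreal (\<bar>f x\<bar> powr p)" for x
  define v where "v x = ennreal (1 / measure M (ball x s))" for x
  have [measurable]: "g \<in> borel_measurable M" "v \<in> borel_measurable M"
    unfolding g_def v_def by measurable
  have pos: "0 < measure M (ball x s)" for x
    by (rule measure_ball_pos[OF \<open>0 < s\<close>])
  interpret pair_sigma_finite M M ..
  have [measurable]: "(\<lambda>(x, y). v x * indicator (ball x s) y * g x) \<in> borel_measurable (M \<Otimes>\<^sub>M M)"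
    "(\<lambda>(x, y). v x * indicator (ball x s) y * g y) \<in> borel_measurable (M \<Otimes>\<^sub>M M)"
    unfolding indicator_def by measurable
  have center: "(\<integral>\<^sup>+x. (\<integral>\<^sup>+y. v x * indicator (ball x s) y * g x \<partial>M) \<partial>M) = (\<integral>\<^sup>+x. g x \<partial>M)"
  proof (rule nn_integral_cong)
    fix x
    have "(\<integral>\<^sup>+y. v x * indicator (ball x s) y * g x \<partial>M) = v x * emeasure M (ball x s) * g x"
      by (simp add: nn_integral_multc nn_integral_cmult_indicator)
    also have "v x * emeasure M (ball x s) = 1"
      using pos[of x] by (simp add: v_def emeasure_ball ennreal_mult'[symmetric])
    finally show "(\<integral>\<^sup>+y. v x * indicator (ball x s) y * g x \<partial>M) = g x"
      by simp
  qed
  have "(\<integral>\<^sup>+x. (\<integral>\<^sup>+y. v x * indicator (ball x s) y * g y \<partial>M) \<partial>M)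
      = (\<integral>\<^sup>+y. (\<integral>\<^sup>+x. v x * indicator (ball x s) y * g y \<partial>M) \<partial>M)"
    by (rule Fubini'[symmetric]) measurable
  also have "\<dots> = (\<integral>\<^sup>+y. (\<integral>\<^sup>+x. v x * indicator (ball y s) x \<partial>M) * g y \<partial>M)"
    by (intro nn_integral_cong, subst nn_integral_multc[symmetric])
      (auto simp: indicator_def dist_commute intro!: nn_integral_cong)
  also have "\<dots> \<le> (\<integral>\<^sup>+y. ennreal doubling_const * g y \<partial>M)"
    using averaged_ball_mass_le[OF \<open>0 < s\<close>]
    by (intro nn_integral_mono mult_right_mono) (auto simp: v_def)
  also have "\<dots> = ennreal doubling_const * (\<integral>\<^sup>+y. g y \<partial>M)"
    by (rule nn_integral_cmult) measurable
  finally have other: "(\<integral>\<^sup>+x. (\<integral>\<^sup>+y. v x * indicator (ball x s) y * g y \<partial>M) \<partial>M) \<le> \<dots>" .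
  have "ball_energy M p f s \<le> (\<integral>\<^sup>+x. (\<integral>\<^sup>+y. ennreal (2 powr p) *
      (v x * indicator (ball x s) y * g x + v x * indicator (ball x s) y * g y) \<partial>M) \<partial>M)"
    unfolding ball_energy_eq
  proof (intro nn_integral_mono)
    fix x y
    have "\<bar>f y - f x\<bar> powr p / measure M (ball x s)
        \<le> 2 powr p * (\<bar>f y\<bar> powr p + \<bar>f x\<bar> powr p) / measure M (ball x s)"
      using abs_diff_powr_le[OF \<open>0 \<le> p\<close>] by (intro divide_right_mono) auto
    then have "ennreal (\<bar>f y - f x\<bar> powr p / measure M (ball x s))
        \<le> ennreal (2 powr p * (\<bar>f y\<bar> powr p + \<bar>f x\<bar> powr p) / measure M (ball x s))"
      by (rule ennreal_leI)
    also have "\<dots> = ennreal (2 powr p) * (v x * g x + v x * g y)"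
      by (simp add: g_def v_def ennreal_mult'[symmetric] ennreal_plus[symmetric] algebra_simps add_divide_distrib
          del: ennreal_plus)
    finally show "ennreal (\<bar>f y - f x\<bar> powr p / measure M (ball x s)) * indicator (ball x s) y
        \<le> ennreal (2 powr p) *
          (v x * indicator (ball x s) y * g x + v x * indicator (ball x s) y * g y)"
      by (simp add: indicator_def)
  qed
  also have "\<dots> = ennreal (2 powr p) *
      ((\<integral>\<^sup>+x. (\<integral>\<^sup>+y. v x * indicator (ball x s) y * g x \<partial>M) \<partial>M) +
       (\<integral>\<^sup>+x. (\<integral>\<^sup>+y. v x * indicator (ball x s) y * g y \<partial>M) \<partial>M))"
    by (simp add: nn_integral_cmult nn_integral_add)
  also have "\<dots> \<le> ennreal (2 powr p) * ((\<integral>\<^sup>+x. g x \<partial>M) + ennreal doubling_const * (\<integral>\<^sup>+x. g x \<partial>M))"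
    unfolding center using other by (intro mult_left_mono add_left_mono) auto
  also have "\<dots> = ennreal (2 powr p * (1 + doubling_const)) * (\<integral>\<^sup>+x. g x \<partial>M)"
    using doubling_const_pos by (simp add: ennreal_mult' ennreal_plus algebra_simps)
  finally show ?thesis
    by (simp add: g_def)
qed

text \<open>
  Bound for the kernel on the shell with outer radius \<open>2 ^ j * r\<close>, relative to the uniform density on
  the ball of that radius: \<open>doubling_const ^ j\<close> pays for the change of normalising volume, and the
  exponential is the decay at the inner radius \<open>2 ^ (j - 1) * r\<close>.  The factor \<open>exp c4\<close> lets the same
  formula cover \<open>j = 0\<close>, where there is no inner radius and no decay.
\<close>
definition shell_weight :: "nat \<Rightarrow> real" where
  "shell_weight j = c3 * exp c4 * (doubling_const ^ j * exp (- (c4 / 2) * 2 ^ j))"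

lemma shell_weight_nonneg: "0 \<le> shell_weight j"
  using constants doubling_const_pos by (simp add: shell_weight_def)

lemma summable_shell_weight_powr: "summable (\<lambda>j. shell_weight j * (2 ^ j) powr a)"
proof -
  have "(2 ^ j) powr a = (2 powr a) ^ j" for j :: nat
    by (simp add: powr_realpow[symmetric] powr_powr mult.commute)
  then have "shell_weight j * (2 ^ j) powr a
      = c3 * exp c4 * ((doubling_const * 2 powr a) ^ j * exp (- (c4 / 2) * 2 ^ j))" for j
    by (simp add: shell_weight_def power_mult_distrib mult_ac)
  then show ?thesis
    using constants doubling_const_pos
    by (simp only: ) (intro summable_mult summable_power_mult_exp_neg_pow2, auto)
qed

text \<open>
  The least \<open>j\<close> with \<open>d < 2 ^ j * r\<close> works: by minimality \<open>d / r \<ge> 2 ^ (j - 1)\<close> unless \<open>j = 0\<close>, and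
  raising a number \<open>\<ge> 1\<close> to the power \<open>\<theta> \<ge> 1\<close> does not decrease it.
\<close>
lemma exists_dyadic_scale:
  assumes "0 \<le> d" "0 < r"
  obtains j where "d < 2 ^ j * r" "exp (- c4 * (d / r) powr \<theta>) \<le> exp c4 * exp (- (c4 / 2) * 2 ^ j)"
proof -
  have "\<exists>j. d / r < 2 ^ j"
    by (rule real_arch_pow) simp
  then have ex: "\<exists>j. d < 2 ^ j * r"
    using assms by (simp add: field_simps)
  define j where "j = (LEAST j. d < 2 ^ j * r)"
  have "d < 2 ^ j * r"
    unfolding j_def using ex by (rule LeastI_ex)
  moreover have "exp (- c4 * (d / r) powr \<theta>) \<le> exp c4 * exp (- (c4 / 2) * 2 ^ j)"
  proof (cases j)
    case 0
    have "- c4 * (d / r) powr \<theta> \<le> 0"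
      using constants by (simp add: mult_nonneg_nonneg)
    also have "0 \<le> c4 + - (c4 / 2) * 2 ^ j"
      using 0 constants by simp
    finally show ?thesis
      by (simp only: exp_add[symmetric] exp_le_cancel_iff)
  next
    case (Suc i)
    have "\<not> d < 2 ^ i * r"
      using Suc not_less_Least[of i "\<lambda>j. d < 2 ^ j * r"] by (simp add: j_def)
    then have "2 ^ i \<le> d / r"
      using assms by (simp add: field_simps)
    moreover have "(1::real) \<le> 2 ^ i"
      by simp
    ultimately have "1 \<le> d / r"
      by linarith
    from powr_mono[OF \<theta>_ge_1 this] have "d / r \<le> (d / r) powr \<theta>"
      using \<open>1 \<le> d / r\<close> by (simp only: powr_one)
    with \<open>2 ^ i \<le> d / r\<close> have "c4 * 2 ^ i \<le> c4 * (d / r) powr \<theta>"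
      using constants by (intro mult_left_mono) auto
    then have "- c4 * (d / r) powr \<theta> \<le> c4 - c4 * 2 ^ i"
      using constants by linarith
    also have "\<dots> = c4 + - (c4 / 2) * 2 ^ j"
      using Suc by simp
    finally show ?thesis
      by (simp only: exp_add[symmetric] exp_le_cancel_iff)
  qed
  ultimately show ?thesis ..
qed

text \<open>
  The single term of the sum that belongs to the shell of \<open>x\<close> already dominates the kernel.  Writing
  the bound as a sum over all balls frees the integration from the choice of the shell.
\<close>
lemma kernel_le_sum_of_balls:
  assumes "0 < r"
  shows "AE y in M. AE x in M. ennreal (k (r powr w) y x) \<le>
    (\<Sum>j. ennreal (shell_weight j) * (ennreal (1 / measure M (ball y (2 ^ j * r))) * indicator (ball y (2 ^ j * r)) x))"
  using doubling_iterated[OF assms] kernel_at_scale[OF assms]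
proof eventually_elim
  case (elim y)
  note dbl = elim(1)
  show ?case
    using elim(2)
  proof eventually_elim
    case (elim x)
    let ?m = "\<lambda>s. measure M (ball y s)"
    let ?F = "\<lambda>j. ennreal (shell_weight j) * (ennreal (1 / ?m (2 ^ j * r)) * indicator (ball y (2 ^ j * r)) x)"
    obtain j where j: "dist y x < 2 ^ j * r"
      "exp (- c4 * (dist y x / r) powr \<theta>) \<le> exp c4 * exp (- (c4 / 2) * 2 ^ j)"
      using exists_dyadic_scale[OF zero_le_dist assms] by blast
    have pos: "0 < ?m r" "0 < ?m (2 ^ j * r)"
      using assms by (auto intro!: measure_ball_pos)
    have "k (r powr w) y x \<le> c3 * exp (- c4 * (dist y x / r) powr \<theta>) / ?m r"
      using elim by simp
    also have "\<dots> \<le> c3 * (exp c4 * exp (- (c4 / 2) * 2 ^ j)) / ?m r"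
      using j constants by (intro divide_right_mono mult_left_mono) auto
    also have "\<dots> \<le> c3 * (exp c4 * exp (- (c4 / 2) * 2 ^ j)) * (doubling_const ^ j / ?m (2 ^ j * r))"
    proof -
      have "1 / ?m r \<le> doubling_const ^ j / ?m (2 ^ j * r)"
        using dbl[rule_format, of j] pos by (simp add: field_simps)
      then show ?thesis
        using constants mult_left_mono[of "1 / ?m r" "doubling_const ^ j / ?m (2 ^ j * r)"
          "c3 * (exp c4 * exp (- (c4 / 2) * 2 ^ j))"] by simp
    qed
    also have "\<dots> = shell_weight j * (1 / ?m (2 ^ j * r))"
      by (simp add: shell_weight_def)
    finally have "ennreal (k (r powr w) y x) \<le> ?F j"
      using j(1) shell_weight_nonneg[of j] by (simp add: ennreal_mult'[symmetric] ennreal_leI)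
    also have "\<dots> \<le> (\<Sum>j. ?F j)"
      using sum_le_suminf[of ?F "{j}"] by simp
    finally show ?case .
  qed
qed

lemma heat_energy_le_sum_ball_energy:
  assumes [measurable]: "f \<in> borel_measurable M" and "0 < r"
  shows "heat_energy M k p f (r powr w) \<le> (\<Sum>j. ennreal (shell_weight j) * ball_energy M p f (2 ^ j * r))"
proof -
  let ?G = "\<lambda>j y x. ennreal (\<bar>f x - f y\<bar> powr p / measure M (ball y (2 ^ j * r)))
    * indicator (ball y (2 ^ j * r)) x"
  have [measurable]: "(\<lambda>(y, x). ?G j y x) \<in> borel_measurable (M \<Otimes>\<^sub>M M)" for j
    by (rule ball_weight_measurable) measurable
  have "heat_energy M k p f (r powr w) \<le> (\<integral>\<^sup>+y. (\<integral>\<^sup>+x. (\<Sum>j. ennreal (shell_weight j) * ?G j y x) \<partial>M) \<partial>M)"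
    unfolding heat_energy_def
  proof (intro nn_integral_mono_AE, use kernel_le_sum_of_balls[OF \<open>0 < r\<close>] in eventually_elim)
    case (elim y)
    show ?case
    proof (rule nn_integral_mono_AE, use elim in eventually_elim)
      case (elim x)
      have "ennreal (\<bar>f x - f y\<bar> powr p * k (r powr w) y x)
          = ennreal (\<bar>f x - f y\<bar> powr p) * ennreal (k (r powr w) y x)"
        by (simp add: ennreal_mult')
      also have "\<dots> \<le> ennreal (\<bar>f x - f y\<bar> powr p) * (\<Sum>j. ennreal (shell_weight j) *
          (ennreal (1 / measure M (ball y (2 ^ j * r))) * indicator (ball y (2 ^ j * r)) x))"
        using elim by (intro mult_left_mono) auto
      also have "\<dots> = (\<Sum>j. ennreal (shell_weight j) * ?G j y x)"
        by (subst ennreal_suminf_cmult[symmetric])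
          (auto intro!: suminf_cong simp: indicator_def shell_weight_nonneg ennreal_mult'[symmetric] mult_ac)
      finally show ?case .
    qed
  qed
  also have "\<dots> = (\<Sum>j. ennreal (shell_weight j) * ball_energy M p f (2 ^ j * r))"
    by (simp add: nn_integral_suminf nn_integral_cmult ball_energy_eq)
  finally show ?thesis .
qed

section \<open>Comparison of the limits\<close>

definition shell_moment :: "real \<Rightarrow> real" where
  "shell_moment a = (\<Sum>j. shell_weight j * (2 ^ j) powr a)"

lemma shell_moment_nonneg: "0 \<le> shell_moment a"
  unfolding shell_moment_def by (intro suminf_nonneg summable_shell_weight_powr) (simp add: shell_weight_nonneg)

text \<open>
  The extra factor \<open>r\<close> in the second term is what makes the contribution of the large scales
  disappear as \<open>r\<close> tends to zero.
\<close>
lemma heat_energy_le_if_ball_energy_le: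
  assumes "f \<in> borel_measurable M" "0 < r" "0 \<le> L" "0 \<le> K"
    and bound: "\<And>s. 0 < s \<Longrightarrow> ball_energy M p f s \<le> ennreal (L * s powr \<gamma> + K * s powr (\<gamma> + 1))"
  shows "heat_energy M k p f (r powr w)
    \<le> ennreal (r powr \<gamma> * (L * shell_moment \<gamma> + r * K * shell_moment (\<gamma> + 1)))"
proof -
  let ?u = "\<lambda>j. r powr \<gamma> * L * (shell_weight j * (2 ^ j) powr \<gamma>)
    + r powr (\<gamma> + 1) * K * (shell_weight j * (2 ^ j) powr (\<gamma> + 1))"
  have "heat_energy M k p f (r powr w) \<le> (\<Sum>j. ennreal (shell_weight j) * ball_energy M p f (2 ^ j * r))"
    by (rule heat_energy_le_sum_ball_energy) fact+
  also have "\<dots> \<le> (\<Sum>j. ennreal (?u j))"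
  proof (intro suminf_le summableI)
    fix j
    have "ennreal (shell_weight j) * ball_energy M p f (2 ^ j * r)
        \<le> ennreal (shell_weight j) * ennreal (L * (2 ^ j * r) powr \<gamma> + K * (2 ^ j * r) powr (\<gamma> + 1))"
      using assms by (intro mult_left_mono bound) auto
    also have "\<dots> = ennreal (?u j)"
      by (simp add: shell_weight_nonneg ennreal_mult'[symmetric] powr_mult algebra_simps)
    finally show "ennreal (shell_weight j) * ball_energy M p f (2 ^ j * r) \<le> ennreal (?u j)" .
  qed
  also have "\<dots> = ennreal (r powr \<gamma> * L * shell_moment \<gamma> + r powr (\<gamma> + 1) * K * shell_moment (\<gamma> + 1))"
  proof (rule suminf_ennreal_eq)
    show "?u sums (r powr \<gamma> * L * shell_moment \<gamma> + r powr (\<gamma> + 1) * K * shell_moment (\<gamma> + 1))"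
      unfolding shell_moment_def by (intro sums_add sums_mult summable_sums summable_shell_weight_powr)
    show "0 \<le> ?u j" for j
      using assms by (intro add_nonneg_nonneg mult_nonneg_nonneg shell_weight_nonneg) auto
  qed
  also have "r powr \<gamma> * L * shell_moment \<gamma> + r powr (\<gamma> + 1) * K * shell_moment (\<gamma> + 1)
      = r powr \<gamma> * (L * shell_moment \<gamma> + r * K * shell_moment (\<gamma> + 1))"
    using \<open>0 < r\<close> by (simp add: powr_add algebra_simps)
  finally show ?thesis .
qed

text \<open>
  For \<open>s \<ge> \<delta>\<close> one has \<open>1 \<le> (s / \<delta>) powr (\<gamma> + 1)\<close>, so the norm bound, a constant, is also a power bound
  with one exponent to spare.
\<close>
lemma ball_energy_interpolated_bound:
  assumes f: "f \<in> Lp_space M p" and "0 \<le> p" "0 < \<delta>" "0 \<le> L" "0 \<le> \<gamma>"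
    and small: "\<And>s. 0 < s \<Longrightarrow> s < \<delta> \<Longrightarrow> ball_energy M p f s \<le> ennreal (L * s powr \<gamma>)"
  obtains K where "0 \<le> K"
    "\<And>s. 0 < s \<Longrightarrow> ball_energy M p f s \<le> ennreal (L * s powr \<gamma> + K * s powr (\<gamma> + 1))"
proof -
  have [measurable]: "f \<in> borel_measurable M" and int: "integrable M (\<lambda>x. \<bar>f x\<bar> powr p)"
    using f by (auto simp: Lp_space_def)
  define K0 where "K0 = 2 powr p * (1 + doubling_const) * (\<integral>x. \<bar>f x\<bar> powr p \<partial>M)"
  have "0 \<le> K0"
    using doubling_const_pos by (simp add: K0_def)
  have K0: "ball_energy M p f s \<le> ennreal K0" if "0 < s" for s
    using ball_energy_le_norm[of f s p] that \<open>0 \<le> p\<close> doubling_const_pos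
    by (simp add: nn_integral_eq_integral[OF int] ennreal_mult'[symmetric] K0_def)
  show ?thesis
  proof (rule that[of "K0 * (1 / \<delta>) powr (\<gamma> + 1)"])
    show "0 \<le> K0 * (1 / \<delta>) powr (\<gamma> + 1)"
      using \<open>0 \<le> K0\<close> by simp
    fix s :: real assume "0 < s"
    show "ball_energy M p f s
        \<le> ennreal (L * s powr \<gamma> + K0 * (1 / \<delta>) powr (\<gamma> + 1) * s powr (\<gamma> + 1))"
    proof (cases "s < \<delta>")
      case True
      then show ?thesis
        using \<open>0 \<le> K0\<close> by (intro order_trans[OF small[OF \<open>0 < s\<close> True] ennreal_leI]) simp
    next
      case False
      have "1 \<le> (1 / \<delta> * s) powr (\<gamma> + 1)"
        using False assms by (intro ge_one_powr_ge_zero) (auto simp: field_simps)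
      then have "K0 * 1 \<le> K0 * (1 / \<delta> * s) powr (\<gamma> + 1)"
        using \<open>0 \<le> K0\<close> by (rule mult_left_mono)
      also have "\<dots> = K0 * (1 / \<delta>) powr (\<gamma> + 1) * s powr (\<gamma> + 1)"
        by (simp add: powr_mult powr_divide)
      also have "\<dots> \<le> L * s powr \<gamma> + K0 * (1 / \<delta>) powr (\<gamma> + 1) * s powr (\<gamma> + 1)"
        using \<open>0 \<le> L\<close> by simp
      finally show ?thesis
        using K0[OF \<open>0 < s\<close>] by (auto elim!: order_trans intro!: ennreal_leI)
    qed
  qed
qed

lemma ball_osc_le_heat_osc:
  assumes "f \<in> borel_measurable M" "0 < r" "0 < p"
  shows "ennreal ((c1 * exp (- c2)) powr (1 / p)) * ball_osc M p (\<alpha> * w) f r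
    \<le> heat_osc M k p \<alpha> f (r powr w)"
proof -
  have "ennreal ((c1 * exp (- c2)) powr (1 / p)) * enn_powr (ball_energy M p f r) (1 / p)
      \<le> enn_powr (heat_energy M k p f (r powr w)) (1 / p)"
    using ball_energy_le_heat_energy[OF assms(1,2), of p] assms constants
    by (subst enn_powr_cmult[symmetric]) (auto intro!: enn_powr_mono)
  then show ?thesis
    using assms constants
    by (auto simp: heat_osc_eq ball_osc_eq mult.left_commute intro!: mult_left_mono)
qed

text \<open>
  The \<open>+ 1\<close> in the constant is room for the large-scale error: it tends to zero and hence is
  eventually below \<open>l powr p\<close>, whatever its dependence on \<open>f\<close>.
\<close>
lemma Limsup_heat_osc_le_of_bound:
  assumes f: "f \<in> Lp_space M p" and "0 < p" "0 \<le> \<alpha>" "0 < l"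
    and less: "Limsup (at_right 0) (ball_osc M p (\<alpha> * w) f) < ennreal l"
  shows "Limsup (at_right 0) (\<lambda>r. heat_osc M k p \<alpha> f (r powr w))
    \<le> ennreal ((shell_moment (\<alpha> * w * p) + 1) powr (1 / p) * l)"
proof -
  have f_meas: "f \<in> borel_measurable M"
    using f by (simp add: Lp_space_def)
  define \<beta> where "\<beta> = \<alpha> * w"
  define \<gamma> where "\<gamma> = \<beta> * p"
  have "0 \<le> \<gamma>"
    using assms constants by (simp add: \<gamma>_def \<beta>_def)
  from Limsup_lessD[OF less] obtain \<delta> where "0 < \<delta>"
    and \<delta>: "\<And>s. 0 < s \<Longrightarrow> s < \<delta> \<Longrightarrow> ball_osc M p \<beta> f s < ennreal l"
    by (auto simp: eventually_at_right_field \<beta>_def)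
  have small: "ball_energy M p f s \<le> ennreal (l powr p * s powr \<gamma>)" if s: "0 < s" "s < \<delta>" for s
  proof -
    have "enn_powr (ball_energy M p f s) (1 / p) = ennreal (s powr \<beta>) * ball_osc M p \<beta> f s"
      using s by (simp add: ball_osc_eq mult.assoc[symmetric] ennreal_mult'[symmetric] powr_add[symmetric])
    also have "\<dots> \<le> ennreal (s powr \<beta>) * ennreal l"
      using \<delta>[OF s] by (intro mult_left_mono) auto
    also have "\<dots> = ennreal (s powr \<beta> * l)"
      by (simp add: ennreal_mult')
    finally have "ball_energy M p f s \<le> ennreal ((s powr \<beta> * l) powr p)"
      using assms by (intro le_if_enn_powr_inverse_le) auto
    then show ?thesis
      by (simp add: powr_mult powr_powr \<gamma>_def mult.commute)
  qed
  obtain K where "0 \<le> K"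
    and K: "\<And>s. 0 < s \<Longrightarrow> ball_energy M p f s \<le> ennreal (l powr p * s powr \<gamma> + K * s powr (\<gamma> + 1))"
    using ball_energy_interpolated_bound[OF f _ \<open>0 < \<delta>\<close> _ \<open>0 \<le> \<gamma>\<close> small] assms by auto
  have "((\<lambda>r. r * K * shell_moment (\<gamma> + 1)) \<longlongrightarrow> 0 * K * shell_moment (\<gamma> + 1)) (at_right 0)"
    by (intro tendsto_intros)
  then have "\<forall>\<^sub>F r in at_right 0. r * K * shell_moment (\<gamma> + 1) < l powr p"
    using \<open>0 < l\<close> by (intro order_tendstoD) auto
  moreover have "\<forall>\<^sub>F r :: real in at_right 0. 0 < r"
    by (rule eventually_at_right_less)
  ultimately have "\<forall>\<^sub>F r in at_right 0.
      heat_osc M k p \<alpha> f (r powr w) \<le> ennreal ((shell_moment \<gamma> + 1) powr (1 / p) * l)"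
  proof eventually_elim
    case (elim r)
    have "heat_energy M k p f (r powr w)
        \<le> ennreal (r powr \<gamma> * (l powr p * shell_moment \<gamma> + r * K * shell_moment (\<gamma> + 1)))"
      using elim \<open>0 \<le> K\<close> by (intro heat_energy_le_if_ball_energy_le f_meas K) auto
    also have "\<dots> \<le> ennreal (r powr \<gamma> * (l powr p * shell_moment \<gamma> + l powr p))"
      using elim by (intro ennreal_leI mult_left_mono add_left_mono) auto
    finally have "enn_powr (heat_energy M k p f (r powr w)) (1 / p)
        \<le> enn_powr (ennreal (r powr \<gamma> * (l powr p * shell_moment \<gamma> + l powr p))) (1 / p)"
      using \<open>0 < p\<close> by (intro enn_powr_mono) auto
    also have "\<dots> = ennreal ((r powr \<gamma> * (l powr p * (shell_moment \<gamma> + 1))) powr (1 / p))"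
      using shell_moment_nonneg by (subst enn_powr_ennreal) (auto simp: algebra_simps)
    also have "(r powr \<gamma> * (l powr p * (shell_moment \<gamma> + 1))) powr (1 / p)
        = r powr \<beta> * (l * (shell_moment \<gamma> + 1) powr (1 / p))"
      using assms by (simp add: powr_mult powr_powr \<gamma>_def)
    finally have "heat_osc M k p \<alpha> f (r powr w)
        \<le> ennreal (r powr (- \<beta>)) * ennreal (r powr \<beta> * (l * (shell_moment \<gamma> + 1) powr (1 / p)))"
      using elim constants by (auto simp: heat_osc_eq \<beta>_def intro!: mult_left_mono)
    also have "\<dots> = ennreal ((shell_moment \<gamma> + 1) powr (1 / p) * l)"
      using elim
      by (simp add: ennreal_mult'[symmetric] mult.assoc[symmetric] powr_add[symmetric])
        (simp add: mult.commute)
    finally show ?case .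
  qed
  then show ?thesis
    unfolding \<gamma>_def \<beta>_def by (rule Limsup_bounded)
qed

lemma Limsup_heat_osc_le:
  assumes f: "f \<in> Lp_space M p" and "0 < p" "0 \<le> \<alpha>"
  shows "Limsup (at_right 0) (\<lambda>r. heat_osc M k p \<alpha> f (r powr w))
    \<le> ennreal ((shell_moment (\<alpha> * w * p) + 1) powr (1 / p)) *
      Limsup (at_right 0) (ball_osc M p (\<alpha> * w) f)"
    (is "?H \<le> ennreal ?C * ?B")
proof -
  have "0 < ?C"
    using shell_moment_nonneg[of "\<alpha> * w * p"] by simp
  show ?thesis
  proof (cases ?B)
    case (real q)
    show ?thesis
    proof (rule ennreal_le_epsilon)
      fix e :: real assume "0 < e"
      have "?H \<le> ennreal (?C * (q + e / ?C))"
        using assms real \<open>0 < e\<close> \<open>0 < ?C\<close>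
        by (intro Limsup_heat_osc_le_of_bound) (auto intro!: add_nonneg_pos ennreal_lessI)
      also have "\<dots> = ennreal ?C * ?B + ennreal e"
        using real \<open>0 < e\<close> \<open>0 < ?C\<close>
        by (simp add: ennreal_mult'[symmetric] ennreal_plus[symmetric] algebra_simps
            del: ennreal_plus)
      finally show "?H \<le> ennreal ?C * ?B + ennreal e" .
    qed
  next
    case top
    then show ?thesis
      using \<open>0 < ?C\<close> by (simp add: ennreal_mult_top)
  qed
qed

end

section \<open>The sub-Markov property of a conservative heat kernel\<close>

text \<open>
  The indicators of the balls \<open>ball x0 n\<close> increase to 1 within \<open>L\<^sup>2\<close>.  A given ball around \<open>x\<close> lies in
  \<open>ball x0 n\<close> for large \<open>n\<close>, so its kernel mass is at most the value of the semigroup on that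
  indicator, and by conservativeness these values tend to 1.
\<close>
lemma (in finite_ball_measure) kernel_mass_on_ball_le_1:
  assumes cons: "conservative M P" and kernel: "continuous_heat_kernel M P k" and "0 < t"
  shows "AE x in M. \<forall>s. (\<integral>\<^sup>+y\<in>ball x s. ennreal (k t x y) \<partial>M) \<le> 1"
proof -
  interpret continuous_heat_kernel M P k by fact
  obtain x0 :: 'a where True by simp
  define u :: "nat \<Rightarrow> 'a \<Rightarrow> real" where "u n = indicator (ball x0 (real n))" for n
  have u_L2: "u n \<in> L2_space M" for n
  proof -
    have "(\<lambda>x. \<bar>u n x\<bar> powr 2) = u n"
      by (auto simp: u_def indicator_def)
    then show ?thesis
      using emeasure_ball_finite[of x0 "real n"] by (simp add: Lp_space_def u_def)
  qed
  have "(\<lambda>n. u n x) \<longlonglongrightarrow> 1" for x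
  proof (rule tendsto_eventually)
    obtain N where "dist x0 x < real N"
      using reals_Archimedean2 by blast
    then show "\<forall>\<^sub>F n in sequentially. u n x = 1"
      by (intro eventually_sequentiallyI[of N]) (simp add: u_def)
  qed
  then have "AE x in M. (\<lambda>n. P t (u n) x) \<longlonglongrightarrow> 1"
    using cons \<open>0 < t\<close> u_L2 unfolding conservative_def
    by (elim allE[of _ t] allE[of _ u] impE) (auto simp: u_def indicator_def)
  moreover have "AE x in M. \<forall>n. integrable M (\<lambda>y. k t x y * u n y) \<and> P t (u n) x = (\<integral>y. k t x y * u n y \<partial>M)"
    by (subst AE_all_countable) (intro allI kernel_represents \<open>0 < t\<close> u_L2)
  ultimately show ?thesis
  proof eventually_elim
    case (elim x)
    show ?case
    proof
      fix s
      obtain N where N: "dist x0 x + s < real N"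
        using reals_Archimedean2 by blast
      have "(\<integral>\<^sup>+y\<in>ball x s. ennreal (k t x y) \<partial>M) \<le> ennreal (P t (u n) x)" if "N \<le> n" for n
      proof -
        have "y \<in> ball x0 (real n)" if "y \<in> ball x s" for y
          using N \<open>N \<le> n\<close> that dist_triangle[of x0 y x] by simp
        then have "(\<integral>\<^sup>+y\<in>ball x s. ennreal (k t x y) \<partial>M) \<le> (\<integral>\<^sup>+y. ennreal (k t x y * u n y) \<partial>M)"
          by (intro nn_integral_mono) (simp add: u_def indicator_def)
        also have "\<dots> = ennreal (\<integral>y. k t x y * u n y \<partial>M)"
          using elim(2) kernel_nonneg[OF \<open>0 < t\<close>]
          by (intro nn_integral_eq_integral) (auto simp: u_def)
        also have "\<dots> = ennreal (P t (u n) x)"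
          using elim(2) by simp
        finally show ?thesis .
      qed
      moreover have "(\<lambda>n. ennreal (P t (u n) x)) \<longlonglongrightarrow> ennreal 1"
        using elim(1) by (rule tendsto_ennrealI)
      ultimately have "(\<integral>\<^sup>+y\<in>ball x s. ennreal (k t x y) \<partial>M) \<le> ennreal 1"
        by (intro tendsto_lowerbound[of _ "ennreal 1" sequentially] eventually_sequentiallyI[of N]) auto
      then show "(\<integral>\<^sup>+y\<in>ball x s. ennreal (k t x y) \<partial>M) \<le> 1"
        by simp
    qed
  qed
qed

section \<open>Besov classes and variation\<close>

theorem theorem3p4:
  fixes M :: "'a::{metric_space, second_countable_topology} measure"
    and E :: "('a \<Rightarrow> real) \<Rightarrow> ('a \<Rightarrow> real) \<Rightarrow> real"
    and F :: "('a \<Rightarrow> real) set"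
    and P :: "real \<Rightarrow> ('a \<Rightarrow> real) \<Rightarrow> ('a \<Rightarrow> real)"
    and k :: "real \<Rightarrow> 'a \<Rightarrow> 'a \<Rightarrow> real"
    and c1 c2 c3 c4 d_W p :: real
  assumes space: "strongly_local_metric_dirichlet_space M E F"
    and balls: "\<And>(x::'a) r. compact (closure (ball x r))"
    and semigroup: "heat_semigroup M E F P"
    and conservative: "conservative M P"
    and kernel: "continuous_heat_kernel M P k"
    and constants: "c1 > 0" "c2 > 0" "c3 > 0" "c4 > 0" "d_W \<ge> 2"
    and estimates: "AE x in M. AE y in M. \<forall>t>0.
          c1 * sub_gaussian M d_W c2 t x y \<le> k t x y \<and>
          k t x y \<le> c3 * sub_gaussian M d_W c4 t x y"
    and p: "p > 1"
    and exponent_pos: "nontrivial_exponents M k p \<noteq> {}"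
    and exponent_finite: "bdd_above (nontrivial_exponents M k p)"
  shows "sobolev M k p =
           {f \<in> Lp_space M p.
              Limsup (at_right 0) (ball_osc M p (critical_exponent M k p * d_W) f) < \<infinity>}
       \<and> (\<exists>c C :: real. c > 0 \<and> C > 0 \<and>
           (\<forall>f\<in>sobolev M k p.
              Var M k p f \<ge> ennreal c *
                Liminf (at_right 0) (ball_osc M p (critical_exponent M k p * d_W) f) \<and>
              Var M k p f \<le> ennreal C *
                Limsup (at_right 0) (ball_osc M p (critical_exponent M k p * d_W) f)))"
proof -
  interpret strongly_local_metric_dirichlet_space M E F by fact
  interpret finite_ball_measure M
  proof
    show "sets M = sets borel"
      by (rule borel_sets)
    fix x :: 'a and r :: real
    have "emeasure M (ball x r) \<le> emeasure M (closure (ball x r))"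
      by (intro emeasure_mono closure_subset) (simp add: borel_sets)
    also have "\<dots> < \<infinity>"
      by (intro finite_on_compacts balls)
    finally show "emeasure M (ball x r) < \<infinity>" .
    show "0 < emeasure M (ball x r)" if "0 < r"
      using that by (intro full_support) auto
  qed
  interpret sub_gaussian_kernel M k c1 c2 c3 c4 d_W
    using constants estimates kernel_mass_on_ball_le_1[OF conservative kernel]
    by unfold_locales auto
  define \<alpha> where "\<alpha> = critical_exponent M k p"
  obtain a where "a \<in> nontrivial_exponents M k p"
    using exponent_pos by auto
  then have "0 < a" "a \<le> \<alpha>"
    using exponent_finite
    by (auto simp: \<alpha>_def critical_exponent_def nontrivial_exponents_def intro!: cSup_upper)
  then have "0 \<le> \<alpha>"
    by simp
  have "0 < d_W" "0 < p"
    using constants p by auto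
  define c where "c = (c1 * exp (- c2)) powr (1 / p)"
  define C where "C = (shell_moment (\<alpha> * d_W * p) + 1) powr (1 / p)"
  have "0 < c" "0 < C"
    using constants shell_moment_nonneg[of "\<alpha> * d_W * p"] by (simp_all add: c_def C_def)
  let ?B = "ball_osc M p (\<alpha> * d_W)" and ?H = "heat_osc M k p \<alpha>"
  have lower: "\<forall>\<^sub>F r in at_right 0. ennreal c * ?B f r \<le> ?H f (r powr d_W)"
    if "f \<in> Lp_space M p" for f
    using that \<open>0 < p\<close>
    by (intro eventually_mono[OF eventually_at_right_less[of 0]])
      (auto simp: c_def Lp_space_def intro!: ball_osc_le_heat_osc)
  have cont: "continuous_on UNIV (\<lambda>x. ennreal c * x)" and mono: "mono (\<lambda>x. ennreal c * x)"
    by (auto intro!: ennreal_continuous_on_cmult continuous_on_id monoI mult_left_mono)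
  have lower_Liminf: "ennreal c * Liminf (at_right 0) (?B f) \<le> Liminf (at_right 0) (?H f)"
    if "f \<in> Lp_space M p" for f
  proof -
    have "ennreal c * Liminf (at_right 0) (?B f) = Liminf (at_right 0) (\<lambda>r. ennreal c * ?B f r)"
      by (rule Liminf_compose_continuous_mono[OF cont mono, symmetric]) simp
    also have "\<dots> \<le> Liminf (at_right 0) (\<lambda>r. ?H f (r powr d_W))"
      by (rule Liminf_mono[OF lower[OF that]])
    finally show ?thesis
      by (simp add: Liminf_at_right_0_powr[OF \<open>0 < d_W\<close>])
  qed
  have lower_Limsup: "ennreal c * Limsup (at_right 0) (?B f) \<le> Limsup (at_right 0) (?H f)"
    if "f \<in> Lp_space M p" for f
  proof -
    have "ennreal c * Limsup (at_right 0) (?B f) = Limsup (at_right 0) (\<lambda>r. ennreal c * ?B f r)"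
      by (rule Limsup_compose_continuous_mono[OF cont mono, symmetric]) simp
    also have "\<dots> \<le> Limsup (at_right 0) (\<lambda>r. ?H f (r powr d_W))"
      by (rule Limsup_mono[OF lower[OF that]])
    finally show ?thesis
      by (simp add: Limsup_at_right_0_powr[OF \<open>0 < d_W\<close>])
  qed
  have upper: "Limsup (at_right 0) (?H f) \<le> ennreal C * Limsup (at_right 0) (?B f)"
    if "f \<in> Lp_space M p" for f
    using Limsup_heat_osc_le[OF that \<open>0 < p\<close> \<open>0 \<le> \<alpha>\<close>]
    by (simp add: C_def Limsup_at_right_0_powr[OF \<open>0 < d_W\<close>])
  have finite_iff: "Limsup (at_right 0) (?H f) < \<infinity> \<longleftrightarrow> Limsup (at_right 0) (?B f) < \<infinity>"
    if "f \<in> Lp_space M p" for f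
  proof
    assume "Limsup (at_right 0) (?H f) < \<infinity>"
    with lower_Limsup[OF that] have "ennreal c * Limsup (at_right 0) (?B f) < \<infinity>"
      by (rule le_less_trans)
    then show "Limsup (at_right 0) (?B f) < \<infinity>"
      using \<open>0 < c\<close> by (auto simp: ennreal_mult_less_top)
  next
    assume "Limsup (at_right 0) (?B f) < \<infinity>"
    then have "ennreal C * Limsup (at_right 0) (?B f) < \<infinity>"
      by (simp add: ennreal_mult_less_top)
    with upper[OF that] show "Limsup (at_right 0) (?H f) < \<infinity>"
      by (rule le_less_trans)
  qed
  have "sobolev M k p = {f \<in> Lp_space M p. Limsup (at_right 0) (?B f) < \<infinity>}"
    using finite_iff by (auto simp: sobolev_def besov_def \<alpha>_def)
  moreover have "ennreal c * Liminf (at_right 0) (?B f) \<le> Var M k p f \<and>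
      Var M k p f \<le> ennreal C * Limsup (at_right 0) (?B f)" if "f \<in> sobolev M k p" for f
  proof -
    have f: "f \<in> Lp_space M p"
      using that by (simp add: sobolev_def besov_def)
    have "Var M k p f = Liminf (at_right 0) (?H f)"
      by (simp add: Var_def \<alpha>_def)
    moreover have "Liminf (at_right 0) (?H f) \<le> Limsup (at_right 0) (?H f)"
      by (rule Liminf_le_Limsup) simp
    ultimately show ?thesis
      using lower_Liminf[OF f] upper[OF f] by auto
  qed
  ultimately show ?thesis
    unfolding \<alpha>_def[symmetric] using \<open>0 < c\<close> \<open>0 < C\<close> by blast
qed

end
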